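(* Let $(M_t)_{t\ge0}$ be a stationary $\rhd$-homogeneous Markov process on $\mathbb R$ with transition kernels $(k_t)_{t\ge0}$. Let $\mathcal B_b(\mathbb R)$ be the set of bounded Borel measurable functions $f:\mathbb R\to\mathbb C$ and let $T_t:\mathcal B_b(\mathbb R)\to\mathcal B_b(\mathbb R)$ be the transition semigroup $$(T_tf)(x)=\int_{\mathbb R}f(y)\,k_t(x,dy),\qquad f\in\mathcal B_b(\mathbb R),$$ which satisfies $T_sT_t=T_{s+t}$ for $s,t\ge0$. Then the generator of the transition semigroup is given by $$(Gf)(x):=\left.\frac{d}{dt}\right|_{t=0}(T_tf)(x)=\gamma f'(x)+\int_{\mathbb R}\left\{(1+y^2)(\partial_x\partial f)(x,y)+yf'(x)\right\}\rho(dy)$$ for $f\in C_b(\mathbb R)\cap C^2(\mathbb R)$ and $x\in\mathbb R$, where $(\gamma,\rho)$ is the generating pair associated to the monotone convolution semigroup $\{k_t(0,\cdot)\}_{t\ge0}$.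
   Context: $\mathbb{C}^+=\{z\in\mathbb{C}:\operatorname{Im} z>0\}$. For a probability measure $\mu$ on $\mathbb{R}$, $G_\mu(z)=\int_{\mathbb R}\frac{1}{z-x}\mu(dx)$ and $F_\mu=1/G_\mu$ on $\mathbb C^+$. The monotone convolution $\mu\rhd\nu$ is the probability measure with $F_{\mu\rhd\nu}=F_\mu\circ F_\nu$. Transition kernels on $\mathbb R$ are probability kernels $(k_{st})_{0\le s\le t}$ with $k_{ss}(x,\cdot)=\delta_x$ and $k_{su}(x,B)=\int k_{st}(x,dy)k_{tu}(y,B)$ for $s\le t\le u$. A Markov process with these kernels is a process $(M_t)$ adapted to a filtration $(\mathcal F_t)$ with $\mathbb P[M_t\in B|\mathcal F_s]=k_{st}(M_s,B)$ a.s. It is $\rhd$-homogeneous if $(s,t)\mapsto k_{st}(x,\cdot)$ is weakly continuous for every $x\in\mathbb R$ and $\delta_x\rhd k_{st}(y,\cdot)=k_{st}(x+y,\cdot)$ for all $x,y\in\mathbb R$, $s\le t$. It is stationary if $k_{st}=k_{0,t-s}$; then one writes $k_t:=k_{0t}$. In the stationary case the measures $k_t(0,\cdot)$ form a weakly continuous $\rhd$-convolution semigroup with $k_0(0,\cdot)=\delta_0$. With $F_t=F_{k_t(0,\cdot)}$, the right derivative $A(z)=\frac{d}{dt}\big|_{t=0}F_t(z)$ exists for $z\in\mathbb C^+$ and has a unique representation $$-A(z)=\gamma+\int_{\mathbb R}\frac{1+zx}{z-x}\,\rho(dx),\qquad z\in\mathbb C^+,$$ with $\gamma\in\mathbb R$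 and $\rho$ a finite non-negative measure on $\mathbb R$ (known fact); $(\gamma,\rho)$ is the generating pair. For $f\in C^1(\mathbb R)$, $(\partial f)(x,y)=\frac{f(x)-f(y)}{x-y}$ for $x\ne y$ and $f'(x)$ for $x=y$. For $f\in C^2(\mathbb R)$, $(\partial_x\partial f)(x,y)=\frac{f(y)-f(x)-(y-x)f'(x)}{(y-x)^2}$ for $x\neq y$ and $\frac12f''(x)$ for $x=y$. $C_b(\mathbb R)$ denotes the bounded continuous functions. *)

theory Defs
  imports "HOL-Probability.Probability"
begin

definition cauchy_transform :: "real measure \<Rightarrow> complex \<Rightarrow> complex" where
  "cauchy_transform \<mu> z = (LINT x|\<mu>. 1 / (z - complex_of_real x))"

definition recip_cauchy_transform :: "real measure \<Rightarrow> complex \<Rightarrow> complex" where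
  "recip_cauchy_transform \<mu> z = 1 / cauchy_transform \<mu> z"

text \<open>
  The monotone convolution of \<open>\<mu>\<close> and \<open>\<nu>\<close> is the unique probability measure whose reciprocal
  Cauchy transform is the composition of those of \<open>\<mu>\<close> and \<open>\<nu>\<close> on the upper half-plane.
  The graph of this operation is defined, so that \<open>is_monotone_convolution \<mu> \<nu> \<kappa>\<close>
  means \<open>\<mu> \<rhd> \<nu> = \<kappa>\<close>.
\<close>
definition is_monotone_convolution ::
    "real measure \<Rightarrow> real measure \<Rightarrow> real measure \<Rightarrow> bool" where
  "is_monotone_convolution \<mu> \<nu> \<kappa> \<longleftrightarrow>
     prob_space \<kappa> \<and> sets \<kappa> = sets borel \<and>
     (\<forall>z. Im z > 0 \<longrightarrow>
        recip_cauchy_transform \<kappa> z = recip_cauchy_transform \<mu> (recip_cauchy_transform \<nu> z))"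

text \<open>
  Time is indexed by \<^typ>\<open>real\<close>; only times \<open>\<ge> 0\<close> are constrained or used.
\<close>
locale transition_kernels =
  fixes k :: "real \<Rightarrow> real \<Rightarrow> real \<Rightarrow> real measure"
  assumes kernel: "\<And>s t. 0 \<le> s \<Longrightarrow> s \<le> t \<Longrightarrow> k s t \<in> borel \<rightarrow>\<^sub>M prob_algebra borel"
    and kernel_refl: "\<And>s x. 0 \<le> s \<Longrightarrow> k s s x = return borel x"
    and chapman_kolmogorov: "\<And>s t u x B. 0 \<le> s \<Longrightarrow> s \<le> t \<Longrightarrow> t \<le> u \<Longrightarrow> B \<in> sets borel \<Longrightarrow>
      emeasure (k s u x) B = (\<integral>\<^sup>+ y. emeasure (k t u y) B \<partial>k s t x)"

locale markov_process = prob_space P + transition_kernels k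
  for P :: "'a measure" and k :: "real \<Rightarrow> real \<Rightarrow> real \<Rightarrow> real measure" +
  fixes Fil :: "real \<Rightarrow> 'a measure" and M :: "real \<Rightarrow> 'a \<Rightarrow> real"
  assumes filtration_subalgebra: "\<And>t. 0 \<le> t \<Longrightarrow> subalgebra P (Fil t)"
    and filtration_mono: "\<And>s t. 0 \<le> s \<Longrightarrow> s \<le> t \<Longrightarrow> sets (Fil s) \<subseteq> sets (Fil t)"
    and adapted: "\<And>t. 0 \<le> t \<Longrightarrow> M t \<in> borel_measurable (Fil t)"
    and markov_property: "\<And>s t B. 0 \<le> s \<Longrightarrow> s \<le> t \<Longrightarrow> B \<in> sets borel \<Longrightarrow>
      AE \<omega> in P. real_cond_exp P (Fil s) (indicat_real (M t -` B \<inter> space P)) \<omega>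
                 = measure (k s t (M s \<omega>)) B"

definition monotone_homogeneous :: "(real \<Rightarrow> real \<Rightarrow> real \<Rightarrow> real measure) \<Rightarrow> bool" where
  "monotone_homogeneous k \<longleftrightarrow>
     (\<forall>x. \<forall>f :: real \<Rightarrow> real. continuous_on UNIV f \<and> bounded (range f) \<longrightarrow>
        continuous_on {(s, t). 0 \<le> s \<and> s \<le> t} (\<lambda>(s, t). LINT y|k s t x. f y)) \<and>
     (\<forall>x y s t. 0 \<le> s \<and> s \<le> t \<longrightarrow>
        is_monotone_convolution (return borel x) (k s t y) (k s t (x + y)))"

definition stationary :: "(real \<Rightarrow> real \<Rightarrow> real \<Rightarrow> real measure) \<Rightarrow> bool" where
  "stationary k \<longleftrightarrow> (\<forall>s t x. 0 \<le> s \<and> s \<le> t \<longrightarrow> k s t x = k 0 (t - s) x)"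

text \<open>
  The pair \<open>(\<gamma>, \<rho>)\<close> generates the family \<open>\<mu>\<^sub>t\<close> if the right derivative \<open>A\<close> at \<open>t = 0\<close> of the
  reciprocal Cauchy transforms exists and \<open>-A(z) = \<gamma> + \<integral> (1 + z x) / (z - x) d\<rho>(x)\<close>
  on the upper half-plane.
\<close>
definition generating_pair :: "(real \<Rightarrow> real measure) \<Rightarrow> real \<Rightarrow> real measure \<Rightarrow> bool" where
  "generating_pair \<mu> \<gamma> \<rho> \<longleftrightarrow>
     finite_measure \<rho> \<and> sets \<rho> = sets borel \<and>
     (\<exists>A. \<forall>z. Im z > 0 \<longrightarrow>
        ((\<lambda>t. recip_cauchy_transform (\<mu> t) z) has_vector_derivative A z) (at 0 within {0..}) \<and>
        - A z = complex_of_real \<gamma> +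
          (LINT x|\<rho>. (1 + z * complex_of_real x) / (z - complex_of_real x)))"

definition bounded_borel :: "(real \<Rightarrow> complex) set" where
  "bounded_borel = {f. f \<in> borel_measurable borel \<and> bounded (range f)}"

definition bounded_continuous :: "(real \<Rightarrow> complex) set" where
  "bounded_continuous = {f. continuous_on UNIV f \<and> bounded (range f)}"

abbreviation vderiv :: "(real \<Rightarrow> complex) \<Rightarrow> real \<Rightarrow> complex" where
  "vderiv f x \<equiv> vector_derivative f (at x)"

definition C2_functions :: "(real \<Rightarrow> complex) set" where
  "C2_functions = {f. f C1_differentiable_on UNIV \<and> vderiv f C1_differentiable_on UNIV}"

text \<open>
  The partial derivative in \<open>x\<close> of the difference quotient \<open>(f x - f y) / (x - y)\<close>,
  extended continuously to the diagonal.
\<close>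
definition dx_diff_quotient :: "(real \<Rightarrow> complex) \<Rightarrow> real \<Rightarrow> real \<Rightarrow> complex" where
  "dx_diff_quotient f x y =
     (if x = y then vderiv (vderiv f) x / 2
      else (f y - f x - complex_of_real (y - x) * vderiv f x) / complex_of_real ((y - x)\<^sup>2))"

definition transition_operator ::
    "(real \<Rightarrow> real \<Rightarrow> real \<Rightarrow> real measure) \<Rightarrow> real \<Rightarrow> (real \<Rightarrow> complex) \<Rightarrow> real \<Rightarrow> complex" where
  "transition_operator k t f x = (LINT y|k 0 t x. f y)"

end

theory Submission
  imports Defs
begin

text \<open>
  Put \<open>\<mu>\<^sub>t = k\<^sub>0\<^sub>t(x, \<cdot>)\<close>. Homogeneity gives \<open>G(z) = 1 / (F\<^sub>t(z) - x)\<close> for the Cauchy transform of \<open>\<mu>\<^sub>t\<close>, so the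
  generating pair determines its derivative at \<open>t = 0\<close>. For every test function \<open>f\<close>, the quotient
  \<open>(T\<^sub>t f(x) - f(x)) / t\<close> equals \<open>b\<^sub>t f'(x) + \<integral> g d\<sigma>\<^sub>t\<close>, where \<open>g\<close> is the integrand of the asserted
  generator, \<open>\<sigma>\<^sub>t(dy) = (y - x)\<^sup>2 / (1 + y\<^sup>2) \<mu>\<^sub>t(dy) / t\<close>, and
  \<open>b\<^sub>t = \<integral> (y - x) (1 + x y) / (1 + y\<^sup>2) \<mu>\<^sub>t(dy) / t\<close>. Taking \<open>f(y) = 1 / (z - y)\<close> turns the known derivative into
  \<open>b\<^sub>t + \<integral> (1 + z y) / (z - y) d\<sigma>\<^sub>t \<longlonglongrightarrow> \<gamma> + \<integral> (1 + z y) / (z - y) d\<rho>\<close> on the upper half-plane, which forces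
  \<open>b\<^sub>t \<longlonglongrightarrow> \<gamma>\<close> and \<open>\<sigma>\<^sub>t \<longlonglongrightarrow> \<rho>\<close> weakly. Since \<open>g\<close> is bounded and continuous for \<open>f\<close> bounded and \<open>C\<^sup>2\<close>, the
  formula follows. Weak convergence is obtained from convergence of Cauchy transforms by Poisson
  smoothing: the smoothed densities converge pointwise, hence in \<open>L\<^sup>1\<close> by Scheffe's lemma, hence so do
  their Fourier transforms, from which the factor of the Cauchy distribution can be divided out.
\<close>

section \<open>Cauchy transforms and weak convergence\<close>

definition poisson_kernel :: "real \<Rightarrow> real \<Rightarrow> real" where
  "poisson_kernel e w = e / (pi * (e\<^sup>2 + w\<^sup>2))"

definition cauchy_distribution :: "real measure" where
  "cauchy_distribution = density lborel (\<lambda>v. ennreal (poisson_kernel 1 v))"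

lemma poisson_kernel_measurable [measurable]: "poisson_kernel e \<in> borel_measurable borel"
  unfolding poisson_kernel_def by measurable

lemma poisson_kernel_nonneg: "0 \<le> e \<Longrightarrow> 0 \<le> poisson_kernel e w"
  unfolding poisson_kernel_def by simp

lemma poisson_kernel_rescale: "0 < e \<Longrightarrow> poisson_kernel e (e * v) = poisson_kernel 1 v / e"
proof -
  assume "0 < e"
  have "e\<^sup>2 + (e * v)\<^sup>2 = e * (e * (1 + v\<^sup>2))"
    by (simp add: power2_eq_square algebra_simps)
  with \<open>0 < e\<close> show ?thesis
    by (simp add: poisson_kernel_def)
qed

lemma poisson_kernel_le: "0 < e \<Longrightarrow> poisson_kernel e w \<le> 1 / (pi * e)"
  unfolding poisson_kernel_def
  by (simp add: divide_simps power2_eq_square add_pos_nonneg add_nonneg_pos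
      not_less [symmetric] zero_less_mult_iff)

lemma has_bochner_integral_poisson_kernel_1: "has_bochner_integral lborel (poisson_kernel 1) 1"
proof -
  have *: "has_bochner_integral lborel (\<lambda>x::real. inverse (1 + x\<^sup>2)) pi"
    using integrable_inverse_1_plus_square LBINT_inverse_1_plus_square
    by (simp add: has_bochner_integral_iff set_integrable_def interval_lebesgue_integral_def
        set_lebesgue_integral_def)
  have "has_bochner_integral lborel (\<lambda>x::real. (1 / pi) * inverse (1 + x\<^sup>2)) ((1 / pi) * pi)"
    by (rule has_bochner_integral_mult_right) (use * in auto)
  moreover have "(\<lambda>x::real. (1 / pi) * inverse (1 + x\<^sup>2)) = poisson_kernel 1"
    by (auto simp: poisson_kernel_def fun_eq_iff field_simps)
  ultimately show ?thesis by simp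
qed

lemma real_distribution_cauchy: "real_distribution cauchy_distribution"
proof -
  have "(\<integral>\<^sup>+ v. ennreal (poisson_kernel 1 v) \<partial>lborel) = ennreal 1"
    using has_bochner_integral_poisson_kernel_1
    by (subst nn_integral_eq_integral) (auto simp: has_bochner_integral_iff poisson_kernel_nonneg)
  then have "prob_space cauchy_distribution"
    unfolding cauchy_distribution_def
    by (intro prob_spaceI) (simp add: emeasure_density cong: nn_integral_cong)
  then show ?thesis
    by (simp add: real_distribution_def real_distribution_axioms_def cauchy_distribution_def)
qed

text \<open>The substitution u = y + e v reduces both claims to scale 1. The characteristic function
  of the Cauchy distribution is left unevaluated: later only its value 1 and its continuity at 0 are
  needed.\<close>

lemma iexp_times_poisson_kernel:
  assumes "0 < e"
  shows "integrable lborel (\<lambda>u. poisson_kernel e (u - y) *\<^sub>R iexp (s * u))"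
    and "(LINT u|lborel. poisson_kernel e (u - y) *\<^sub>R iexp (s * u)) =
         iexp (s * y) * char cauchy_distribution (e * s)"
proof -
  let ?g = "\<lambda>u. poisson_kernel e (u - y) *\<^sub>R iexp (s * u)"
  have shift: "?g (y + e * v) = (iexp (s * y) / e) * (poisson_kernel 1 v *\<^sub>R iexp (e * s * v))" for v
    using assms by (simp add: poisson_kernel_rescale exp_add [symmetric] algebra_simps
        scaleR_conv_of_real)
  have int: "integrable lborel (\<lambda>v. poisson_kernel 1 v *\<^sub>R iexp (e * s * v))"
  proof (rule Bochner_Integration.integrable_bound)
    show "integrable lborel (poisson_kernel 1)"
      using has_bochner_integral_poisson_kernel_1 by (simp add: has_bochner_integral_iff)
    show "AE v in lborel. norm (poisson_kernel 1 v *\<^sub>R iexp (e * s * v))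
        \<le> norm (poisson_kernel 1 v)"
      unfolding norm_scaleR norm_exp_i_times by simp
  qed measurable
  have char: "(LINT v|lborel. poisson_kernel 1 v *\<^sub>R iexp (e * s * v)) =
      char cauchy_distribution (e * s)"
    unfolding char_def cauchy_distribution_def
    by (subst integral_density) (auto simp: poisson_kernel_nonneg)
  have "integrable lborel (\<lambda>v. ?g (y + e * v))"
    unfolding shift by (rule integrable_mult_right) (rule int)
  then show "integrable lborel ?g"
    using assms by (subst (asm) lborel_integrable_real_affine_iff) auto
  have "(LINT u|lborel. ?g u) = \<bar>e\<bar> *\<^sub>R (LINT v|lborel. ?g (y + e * v))"
    using assms by (intro lborel_integral_real_affine) auto
  then show "(LINT u|lborel. ?g u) = iexp (s * y) * char cauchy_distribution (e * s)"
    unfolding shift integral_mult_right_zero char using assms by (simp add: scaleR_conv_of_real)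
qed

text \<open>As a function of u, this is the density of the convolution of \<open>N\<close> with the
  Cauchy distribution of scale \<open>e\<close>.\<close>

definition poisson_integral :: "real measure \<Rightarrow> real \<Rightarrow> real \<Rightarrow> real" where
  "poisson_integral N e u = (LINT y|N. poisson_kernel e (u - y))"

context real_distribution
begin

lemma integrable_poisson_kernel: "0 < e \<Longrightarrow> integrable M (\<lambda>y. poisson_kernel e (u - y))"
  by (rule integrable_const_bound [where B = "1 / (pi * e)"])
    (auto simp: poisson_kernel_nonneg poisson_kernel_le)

text \<open>Stieltjes inversion: the imaginary part of 1 / (u + i e - y) is -e / ((u - y)^2 + e^2).
  Hence convergence of Cauchy transforms on the line of height \<open>e\<close> is pointwise
  convergence of the smoothed densities.\<close>

lemma poisson_integral_eq_Im_cauchy: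
  assumes "0 < e"
  shows "poisson_integral M e u = - Im (cauchy_transform M (Complex u e)) / pi"
proof -
  have ne: "Complex u e - complex_of_real y \<noteq> 0" for y
    using assms by (auto simp: complex_eq_iff)
  have "e \<le> norm (Complex u e - complex_of_real y)" for y
    using abs_Im_le_cmod [of "Complex u e - complex_of_real y"] assms by simp
  then have "integrable M (\<lambda>y. 1 / (Complex u e - complex_of_real y))"
    using assms ne by (intro integrable_const_bound [where B = "1 / e"])
      (auto simp: norm_divide divide_simps)
  then have "Im (cauchy_transform M (Complex u e)) =
      (LINT y|M. Im (1 / (Complex u e - complex_of_real y)))"
    unfolding cauchy_transform_def by simp
  also have "\<dots> = (LINT y|M. - pi * poisson_kernel e (u - y))"
    by (intro Bochner_Integration.integral_cong)
      (use assms in \<open>auto simp: Im_divide poisson_kernel_def add.commute\<close>)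
  finally show ?thesis
    by (simp add: poisson_integral_def)
qed

lemma poisson_integral_nonneg: "0 < e \<Longrightarrow> 0 \<le> poisson_integral M e u"
  unfolding poisson_integral_def by (intro integral_nonneg_AE AE_I2) (simp add: poisson_kernel_nonneg)

text \<open>The Fourier transform of a convolution is a product; the exchange of integrals is
  Fubini.\<close>

lemma iexp_times_poisson_integral:
  assumes "0 < e"
  shows "integrable lborel (\<lambda>u. poisson_integral M e u *\<^sub>R iexp (s * u))" (is ?int)
    and "(LINT u|lborel. poisson_integral M e u *\<^sub>R iexp (s * u)) =
         char M s * char cauchy_distribution (e * s)" (is ?eq)
proof -
  interpret L: pair_sigma_finite M lborel ..
  let ?g = "\<lambda>y u. poisson_kernel e (u - y) *\<^sub>R iexp (s * u)"
  \<comment> \<open>The norm of the integrand does not depend on \<open>s\<close>, so the case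
    \<open>s = 0\<close> of the kernel formula computes its integral.\<close>
  have norm_int: "(LINT u|lborel. norm (?g y u)) = 1" for y
  proof -
    have "complex_of_real (LINT u|lborel. norm (?g y u)) =
        (LINT u|lborel. poisson_kernel e (u - y) *\<^sub>R iexp (0 * u))"
      using assms by (simp add: poisson_kernel_nonneg norm_mult scaleR_conv_of_real)
    also have "\<dots> = 1"
      unfolding iexp_times_poisson_kernel(2) [OF assms]
      using real_distribution.char_zero [OF real_distribution_cauchy] by simp
    finally show ?thesis by simp
  qed
  have int: "integrable (M \<Otimes>\<^sub>M lborel) (\<lambda>(y, u). ?g y u)"
  proof (rule L.Fubini_integrable)
    show "integrable M (\<lambda>y. LINT u|lborel. norm (case (y, u) of (y, u) \<Rightarrow> ?g y u))"
      unfolding prod.case norm_int by simp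
    show "AE y in M. integrable lborel (\<lambda>u. case (y, u) of (y, u) \<Rightarrow> ?g y u)"
      unfolding prod.case using iexp_times_poisson_kernel(1) [OF assms] by simp
  qed measurable
  have inner: "(LINT y|M. ?g y u) = poisson_integral M e u *\<^sub>R iexp (s * u)" for u
    unfolding poisson_integral_def
    using integrable_poisson_kernel [OF assms] by (intro integral_scaleR_left) auto
  show ?int
    using L.integrable_snd [of ?g] int unfolding inner by simp
  show ?eq
    using L.Fubini_integral [of ?g] int assms
    unfolding inner iexp_times_poisson_kernel(2) [OF assms] by (simp add: char_def)
qed

lemma has_bochner_integral_poisson_integral:
  assumes "0 < e"
  shows "has_bochner_integral lborel (poisson_integral M e) 1"
proof -
  have "integrable lborel (\<lambda>u. complex_of_real (poisson_integral M e u))"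
    and "(LINT u|lborel. complex_of_real (poisson_integral M e u)) = of_real 1"
    using iexp_times_poisson_integral [OF assms, of 0] char_zero
      real_distribution.char_zero [OF real_distribution_cauchy]
    by (simp_all add: scaleR_conv_of_real)
  then show ?thesis
    unfolding has_bochner_integral_iff complex_of_real_integrable_eq integral_complex_of_real
      of_real_eq_iff by simp
qed

end

text \<open>Only small smoothing scales matter, so convergence in the strip 0 < Im z < 1 suffices.
  This leaves out z = i, where the Nevanlinna kernel is constant and carries no information about
  the Cauchy transform.\<close>

lemma weak_conv_of_cauchy_transform:
  assumes N: "\<And>n. real_distribution (N n)" and N': "real_distribution N'"
    and conv: "\<And>z. 0 < Im z \<Longrightarrow> Im z < 1 \<Longrightarrow>
      (\<lambda>n. cauchy_transform (N n) z) \<longlonglongrightarrow> cauchy_transform N' z"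
  shows "weak_conv_m N N'"
proof (rule levy_continuity [OF N N'])
  fix s :: real
  interpret N: real_distribution "N n" for n by (rule N)
  interpret N': real_distribution N' by (rule N')
  interpret C: real_distribution cauchy_distribution by (rule real_distribution_cauchy)
  \<comment> \<open>The scale \<open>e\<close> may depend on the frequency \<open>s\<close>: by
    continuity at 0 the Cauchy factor is nonzero once \<open>e\<close> is small, so it can be
    divided out at the end.\<close>
  have "((\<lambda>e. char cauchy_distribution (e * s)) \<longlongrightarrow> 1) (at_right 0)"
    by (rule isCont_tendsto_compose [of 0 "char cauchy_distribution" "\<lambda>e. e * s", unfolded C.char_zero])
      (auto intro!: tendsto_eq_intros C.isCont_char)
  then have "\<forall>\<^sub>F e in at_right 0. char cauchy_distribution (e * s) \<noteq> 0"
    by (rule tendsto_imp_eventually_ne) simp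
  moreover have "\<forall>\<^sub>F e::real in at_right 0. e \<in> {0<..<1}"
    by (rule eventually_at_right_real) simp
  ultimately have "\<forall>\<^sub>F e::real in at_right 0. e \<in> {0<..<1} \<and> char cauchy_distribution (e * s) \<noteq> 0"
    by eventually_elim simp
  then obtain e :: real where e: "0 < e" "e < 1" and ne: "char cauchy_distribution (e * s) \<noteq> 0"
    by (auto dest!: eventually_happens)
  have h: "(\<lambda>n. poisson_integral (N n) e u) \<longlonglongrightarrow> poisson_integral N' e u" for u
    unfolding N.poisson_integral_eq_Im_cauchy [OF e(1)] N'.poisson_integral_eq_Im_cauchy [OF e(1)]
    using e by (intro tendsto_intros conv) auto
  have one: "(\<integral>\<^sup>+ u. norm (poisson_integral K e u) \<partial>lborel) = 1" if "real_distribution K" for K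
    using real_distribution.has_bochner_integral_poisson_integral [OF that e(1)]
      real_distribution.poisson_integral_nonneg [OF that e(1)]
    by (subst nn_integral_eq_integral) (auto simp: has_bochner_integral_iff)
  \<comment> \<open>All smoothed densities have integral 1, so Scheffe's lemma upgrades pointwise
    convergence to L1 convergence, and no tightness argument is needed.\<close>
  have L1: "(\<lambda>n. \<integral>\<^sup>+ u. norm (poisson_integral (N n) e u - poisson_integral N' e u) \<partial>lborel) \<longlonglongrightarrow> 0"
  proof (rule Scheffe_lemma1)
    show "limsup (\<lambda>n. \<integral>\<^sup>+ u. norm (poisson_integral (N n) e u) \<partial>lborel)
        \<le> (\<integral>\<^sup>+ u. norm (poisson_integral N' e u) \<partial>lborel)"
      unfolding one [OF N] one [OF N'] by (simp add: Limsup_const)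
  qed (use h N.has_bochner_integral_poisson_integral N'.has_bochner_integral_poisson_integral e in
      \<open>auto simp: has_bochner_integral_iff\<close>)
  have "(\<lambda>n. LINT u|lborel. poisson_integral (N n) e u *\<^sub>R iexp (s * u)) \<longlonglongrightarrow>
      (LINT u|lborel. poisson_integral N' e u *\<^sub>R iexp (s * u))"
  proof (rule tendsto_L1_int)
    show "(\<lambda>n. \<integral>\<^sup>+ u. norm (poisson_integral (N n) e u *\<^sub>R iexp (s * u) -
        poisson_integral N' e u *\<^sub>R iexp (s * u)) \<partial>lborel) \<longlonglongrightarrow> 0"
      using L1 by (simp add: scaleR_diff_left [symmetric])
  qed (use e N.iexp_times_poisson_integral N'.iexp_times_poisson_integral in auto)
  then have "(\<lambda>n. char (N n) s * char cauchy_distribution (e * s)) \<longlonglongrightarrow>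
      char N' s * char cauchy_distribution (e * s)"
    by (simp only: N.iexp_times_poisson_integral(2) [OF e(1)]
        N'.iexp_times_poisson_integral(2) [OF e(1)])
  from tendsto_divide [OF this tendsto_const ne] ne
  show "(\<lambda>n. char (N n) s) \<longlonglongrightarrow> char N' s"
    by simp
qed

section \<open>From probability measures to finite measures\<close>

definition normalize_measure :: "real measure \<Rightarrow> real measure" where
  "normalize_measure N = density N (\<lambda>_. ennreal (1 / measure N UNIV))"

lemma
  fixes f :: "real \<Rightarrow> 'b::{banach, second_countable_topology}"
  assumes "finite_measure N" "sets N = sets borel" "0 < measure N UNIV"
  shows real_distribution_normalize_measure: "real_distribution (normalize_measure N)"
    and integral_normalize_measure: "f \<in> borel_measurable borel \<Longrightarrow>
      integral\<^sup>L (normalize_measure N) f = integral\<^sup>L N f /\<^sub>R measure N UNIV"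
proof -
  interpret finite_measure N by fact
  have sp: "space N = UNIV"
    using sets_eq_imp_space_eq [OF assms(2)] by simp
  have "emeasure (normalize_measure N) (space (normalize_measure N)) =
      ennreal (1 / measure N UNIV) * emeasure N UNIV"
    unfolding normalize_measure_def
    by (subst emeasure_density) (auto simp: sp nn_integral_cmult_indicator sets.top [of N, unfolded sp])
  also have "\<dots> = 1"
    using assms(3) by (simp add: emeasure_eq_measure ennreal_mult [symmetric])
  finally show "real_distribution (normalize_measure N)"
    by (intro real_distribution.intro real_distribution_axioms.intro prob_spaceI)
      (auto simp: normalize_measure_def assms)
  assume "f \<in> borel_measurable borel"
  then have "f \<in> borel_measurable N"
    using measurable_cong_sets [OF assms(2) refl] by blast
  then show "integral\<^sup>L (normalize_measure N) f = integral\<^sup>L N f /\<^sub>R measure N UNIV"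
    unfolding normalize_measure_def using assms by (subst integral_density) (auto simp: divide_inverse)
qed

lemma borel_measurable_cauchy_kernel:
  "(\<lambda>x. 1 / (z - complex_of_real x)) \<in> borel_measurable borel"
  by measurable

lemma cauchy_transform_normalize_measure:
  assumes "finite_measure N" "sets N = sets borel" "0 < measure N UNIV"
  shows "cauchy_transform (normalize_measure N) z = cauchy_transform N z /\<^sub>R measure N UNIV"
  unfolding cauchy_transform_def
  by (rule integral_normalize_measure [OF assms borel_measurable_cauchy_kernel])

lemma norm_integral_le_mass:
  fixes g :: "real \<Rightarrow> 'b::{banach, second_countable_topology}"
  assumes "finite_measure N" "sets N = sets borel" "\<And>y. norm (g y) \<le> C"
  shows "norm (integral\<^sup>L N g) \<le> C * measure N UNIV"
proof -
  interpret finite_measure N by fact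
  have sp: "space N = UNIV"
    using sets_eq_imp_space_eq [OF assms(2)] by simp
  have "0 \<le> C"
    using assms(3) [of 0] norm_ge_zero order_trans by blast
  have "norm (integral\<^sup>L N g) \<le> (LINT y|N. C)"
    using assms(3) \<open>0 \<le> C\<close>
    by (intro order_trans [OF integral_norm_bound integral_mono']) auto
  then show ?thesis
    by (simp add: sp mult.commute)
qed

text \<open>Dividing by the total masses reduces the claim to probability measures. A limit of mass
  0 cannot be normalized, but then all integrals of a bounded \<open>g\<close> vanish in the
  limit.\<close>

lemma integral_tendsto_of_cauchy_transform:
  fixes g :: "real \<Rightarrow> 'b::{banach, second_countable_topology}"
  assumes N: "\<And>n. finite_measure (N n)" "\<And>n. sets (N n) = sets borel"
    and N': "finite_measure N'" "sets N' = sets borel"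
    and mass: "(\<lambda>n. measure (N n) UNIV) \<longlonglongrightarrow> measure N' UNIV"
    and conv: "\<And>z. 0 < Im z \<Longrightarrow> Im z < 1 \<Longrightarrow>
      (\<lambda>n. cauchy_transform (N n) z) \<longlonglongrightarrow> cauchy_transform N' z"
    and g: "continuous_on UNIV g" "bounded (range g)"
  shows "(\<lambda>n. integral\<^sup>L (N n) g) \<longlonglongrightarrow> integral\<^sup>L N' g"
proof -
  obtain C where C: "\<And>y. norm (g y) \<le> C"
    using g(2) by (auto simp: bounded_iff)
  have g_meas: "g \<in> borel_measurable borel"
    using g(1) by (rule borel_measurable_continuous_onI)
  show ?thesis
  proof (cases "measure N' UNIV = 0")
    case True
    have "(\<lambda>n. integral\<^sup>L (N n) g) \<longlonglongrightarrow> 0"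
    proof (rule Lim_null_comparison)
      show "\<forall>\<^sub>F n in sequentially. norm (integral\<^sup>L (N n) g) \<le> C * measure (N n) UNIV"
        using norm_integral_le_mass [OF N C] by simp
      show "(\<lambda>n. C * measure (N n) UNIV) \<longlonglongrightarrow> 0"
        using tendsto_mult_left [OF mass, of C] True by simp
    qed
    moreover have "integral\<^sup>L N' g = 0"
      using norm_integral_le_mass [OF N' C] True by simp
    ultimately show ?thesis by simp
  next
    case False
    then have pos': "0 < measure N' UNIV"
      by (simp add: zero_less_measure_iff)
    have ev: "\<forall>\<^sub>F n in sequentially. 0 < measure (N n) UNIV"
      using order_tendstoD(1) [OF mass pos'] .
    \<comment> \<open>The limit \<open>N'\<close> serves as a placeholder at the finitely many
      indices where the mass may vanish, so that every \<open>Q n\<close> is a probability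
      measure.\<close>
    define Q where "Q n = normalize_measure (if 0 < measure (N n) UNIV then N n else N')" for n
    have Q: "real_distribution (Q n)" for n
      unfolding Q_def using N N' pos' by (auto intro!: real_distribution_normalize_measure)
    have "weak_conv_m Q (normalize_measure N')"
    proof (rule weak_conv_of_cauchy_transform [OF Q real_distribution_normalize_measure [OF N' pos']])
      fix z assume z: "0 < Im z" "Im z < 1"
      have "(\<lambda>n. cauchy_transform (N n) z /\<^sub>R measure (N n) UNIV)
          \<longlonglongrightarrow> cauchy_transform N' z /\<^sub>R measure N' UNIV"
        using False by (intro tendsto_intros conv mass z)
      moreover have "\<forall>\<^sub>F n in sequentially.
          cauchy_transform (Q n) z = cauchy_transform (N n) z /\<^sub>R measure (N n) UNIV"
        using ev by eventually_elim (simp add: Q_def cauchy_transform_normalize_measure N)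
      ultimately show "(\<lambda>n. cauchy_transform (Q n) z) \<longlonglongrightarrow> cauchy_transform (normalize_measure N') z"
        unfolding cauchy_transform_normalize_measure [OF N' pos'] by (simp add: tendsto_cong)
    qed
    then have "(\<lambda>n. integral\<^sup>L (Q n) g) \<longlonglongrightarrow> integral\<^sup>L (normalize_measure N') g"
      using g(1) C Q real_distribution_normalize_measure [OF N' pos']
      by (intro weak_conv_imp_integral_bdd_continuous_conv [where B = C])
        (auto simp: continuous_on_eq_continuous_at)
    then have "(\<lambda>n. measure (N n) UNIV *\<^sub>R integral\<^sup>L (Q n) g)
        \<longlonglongrightarrow> measure N' UNIV *\<^sub>R integral\<^sup>L (normalize_measure N') g"
      by (intro tendsto_intros mass)
    moreover have "\<forall>\<^sub>F n in sequentially.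
        measure (N n) UNIV *\<^sub>R integral\<^sup>L (Q n) g = integral\<^sup>L (N n) g"
      using ev by eventually_elim (simp add: Q_def integral_normalize_measure [OF N _ g_meas])
    ultimately show ?thesis
      unfolding integral_normalize_measure [OF N' pos' g_meas] using False by (simp add: tendsto_cong)
  qed
qed

section \<open>Continuity of the Nevanlinna representation\<close>

definition nevanlinna_kernel :: "complex \<Rightarrow> real \<Rightarrow> complex" where
  "nevanlinna_kernel z y = (1 + z * complex_of_real y) / (z - complex_of_real y)"

lemma nevanlinna_kernel_measurable [measurable]: "nevanlinna_kernel z \<in> borel_measurable borel"
  unfolding nevanlinna_kernel_def by measurable

lemma nonreal_minus_real: "0 < Im z \<Longrightarrow> z - complex_of_real y \<noteq> 0"
  by (auto simp: complex_eq_iff)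

text \<open>Division with remainder in y: the kernel is affine in the Cauchy kernel, so its integral
  is determined by the total mass and the Cauchy transform.\<close>

lemma nevanlinna_kernel_eq:
  assumes "0 < Im z"
  shows "nevanlinna_kernel z y = - z + (1 + z\<^sup>2) * (1 / (z - complex_of_real y))"
  using nonreal_minus_real [OF assms, of y]
  by (simp add: nevanlinna_kernel_def divide_simps) (simp add: algebra_simps power2_eq_square)

lemma norm_cauchy_kernel_le:
  assumes "0 < Im z"
  shows "norm (1 / (z - complex_of_real y)) \<le> 1 / Im z"
  using abs_Im_le_cmod [of "z - complex_of_real y"] assms
  by (simp add: norm_divide divide_simps)

lemma norm_nevanlinna_kernel_le:
  assumes "0 < Im z"
  shows "norm (nevanlinna_kernel z y) \<le> norm z + norm (1 + z\<^sup>2) * (1 / Im z)"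
proof -
  have "norm ((1 + z\<^sup>2) * (1 / (z - complex_of_real y))) \<le> norm (1 + z\<^sup>2) * (1 / Im z)"
    unfolding norm_mult using norm_cauchy_kernel_le [OF assms] by (intro mult_left_mono) auto
  then show ?thesis
    unfolding nevanlinna_kernel_eq [OF assms] by (smt (verit) norm_minus_cancel norm_triangle_ineq)
qed

lemma integral_nevanlinna_kernel:
  assumes N: "finite_measure N" "sets N = sets borel" and z: "0 < Im z"
  shows "integral\<^sup>L N (nevanlinna_kernel z) =
    - z * measure N UNIV + (1 + z\<^sup>2) * cauchy_transform N z"
proof -
  interpret finite_measure N by fact
  have sp: "space N = UNIV"
    using sets_eq_imp_space_eq [OF N(2)] by simp
  have "(\<lambda>y. 1 / (z - complex_of_real y)) \<in> borel_measurable N"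
    using borel_measurable_cauchy_kernel measurable_cong_sets [OF N(2) refl] by blast
  then have "integrable N (\<lambda>y. 1 / (z - complex_of_real y))"
    using norm_cauchy_kernel_le [OF z] by (intro integrable_const_bound [where B = "1 / Im z"]) auto
  then show ?thesis
    unfolding nevanlinna_kernel_eq [OF z] cauchy_transform_def
    by (subst Bochner_Integration.integral_add) (simp_all add: sp scaleR_conv_of_real del: times_divide_eq_right)
qed

text \<open>Convergence of the functions represented by the pairs (\<open>b n\<close>,
  \<open>N n\<close>) forces convergence of the pairs: first the constants and masses, then the
  Cauchy transforms, then the integrals of bounded continuous functions.\<close>

lemma nevanlinna_continuity:
  fixes g :: "real \<Rightarrow> 'b::{banach, second_countable_topology}"
  assumes N: "\<And>n. finite_measure (N n)" "\<And>n. sets (N n) = sets borel"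
    and N': "finite_measure N'" "sets N' = sets borel"
    and conv: "\<And>z. 0 < Im z \<Longrightarrow>
      (\<lambda>n. complex_of_real (b n) + integral\<^sup>L (N n) (nevanlinna_kernel z))
        \<longlonglongrightarrow> complex_of_real b' + integral\<^sup>L N' (nevanlinna_kernel z)"
  shows "b \<longlonglongrightarrow> b'"
    and "continuous_on UNIV g \<Longrightarrow> bounded (range g) \<Longrightarrow>
      (\<lambda>n. integral\<^sup>L (N n) g) \<longlonglongrightarrow> integral\<^sup>L N' g"
proof -
  text \<open>At \<open>z = \<i>\<close> the kernel is the constant \<open>- \<i>\<close>, so the real part isolates \<open>b\<close> and the
    imaginary part the total mass.\<close>
  have "(\<lambda>n. complex_of_real (b n) + - \<i> * measure (N n) UNIV)
      \<longlonglongrightarrow> complex_of_real b' + - \<i> * measure N' UNIV"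
    using conv [of \<i>] by (simp add: integral_nevanlinna_kernel N N')
  from tendsto_Re [OF this] tendsto_Im [OF this]
  have b: "b \<longlonglongrightarrow> b'" and mass: "(\<lambda>n. measure (N n) UNIV) \<longlonglongrightarrow> measure N' UNIV"
    by (simp_all add: tendsto_minus_cancel_left [symmetric])
  show "b \<longlonglongrightarrow> b'"
    by (rule b)
  \<comment> \<open>Recovering the Cauchy transform means dividing by 1 + z^2, whose zeros i and -i
    lie outside the strip 0 < Im z < 1.\<close>
  have "(\<lambda>n. cauchy_transform (N n) z) \<longlonglongrightarrow> cauchy_transform N' z" if z: "0 < Im z" "Im z < 1" for z
  proof -
    have "1 + z\<^sup>2 = (z - \<i>) * (z + \<i>)"
      by (simp add: algebra_simps power2_eq_square)
    moreover have "z \<noteq> \<i>" "z \<noteq> - \<i>"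
      using z by auto
    ultimately have ne: "1 + z\<^sup>2 \<noteq> 0"
      by (simp add: eq_neg_iff_add_eq_0)
    have eq: "cauchy_transform K z = ((complex_of_real c + integral\<^sup>L K (nevanlinna_kernel z)) -
        complex_of_real c + z * measure K UNIV) / (1 + z\<^sup>2)"
      if "finite_measure K" "sets K = sets borel" for K c
      using ne by (simp add: integral_nevanlinna_kernel that z field_simps)
    have "(\<lambda>n. ((complex_of_real (b n) + integral\<^sup>L (N n) (nevanlinna_kernel z)) -
        complex_of_real (b n) + z * measure (N n) UNIV) / (1 + z\<^sup>2))
      \<longlonglongrightarrow> ((complex_of_real b' + integral\<^sup>L N' (nevanlinna_kernel z)) -
        complex_of_real b' + z * measure N' UNIV) / (1 + z\<^sup>2)"
      using ne by (intro tendsto_intros conv b mass z)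
    then show ?thesis
      by (simp only: eq [OF N, symmetric] eq [OF N', symmetric])
  qed
  then show "(\<lambda>n. integral\<^sup>L (N n) g) \<longlonglongrightarrow> integral\<^sup>L N' g"
    if "continuous_on UNIV g" "bounded (range g)"
    by (rule integral_tendsto_of_cauchy_transform [OF N N' mass]) (use that in auto)
qed

section \<open>The integrand of the generator\<close>

text \<open>For bounded \<open>f\<close> the first summand grows like -y f'(x) at infinity; the
  second summand cancels this growth, which makes the sum bounded.\<close>

definition generator_integrand :: "(real \<Rightarrow> complex) \<Rightarrow> real \<Rightarrow> real \<Rightarrow> complex" where
  "generator_integrand f x y =
     complex_of_real (1 + y\<^sup>2) * dx_diff_quotient f x y + complex_of_real y * vderiv f x"

lemma C2_functionsD:
  assumes "f \<in> C2_functions"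
  shows "(f has_vector_derivative vderiv f x) (at x)"
    and "(vderiv f has_vector_derivative vderiv (vderiv f) x) (at x)"
proof -
  have "f differentiable (at x)" "vderiv f differentiable (at x)"
    using assms by (simp_all add: C2_functions_def C1_differentiable_on_eq)
  then show "(f has_vector_derivative vderiv f x) (at x)"
    "(vderiv f has_vector_derivative vderiv (vderiv f) x) (at x)"
    unfolding vector_derivative_works by blast+
qed

lemma dx_diff_quotient_tendsto_diagonal:
  assumes "f \<in> C2_functions"
  shows "(dx_diff_quotient f x \<longlongrightarrow> dx_diff_quotient f x x) (at x)"
proof -
  define c where "c = vderiv (vderiv f) x"
  define r where "r y = f y - (y - x) *\<^sub>R vderiv f x - ((y - x)\<^sup>2 / 2) *\<^sub>R c" for y
  have r': "(r has_vector_derivative (vderiv f y - vderiv f x - (y - x) *\<^sub>R c)) (at y)" for y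
    unfolding r_def
    by (auto intro!: derivative_eq_intros C2_functionsD [OF assms])
  show ?thesis
  proof (rule tendstoI)
    fix e :: real assume "0 < e"
    then have "0 < e / 2"
      by simp
    with C2_functionsD(2) [OF assms, of x, unfolded has_vector_derivative_def has_derivative_at_alt]
    have "\<exists>d>0. \<forall>y. norm (y - x) < d \<longrightarrow>
        norm (vderiv f y - vderiv f x - (y - x) *\<^sub>R c) \<le> e / 2 * norm (y - x)"
      unfolding c_def by blast
    then obtain d where d: "0 < d" "\<And>y. \<bar>y - x\<bar> < d \<Longrightarrow>
        norm (vderiv f y - vderiv f x - (y - x) *\<^sub>R c) \<le> (e / 2) * \<bar>y - x\<bar>"
      by auto
    have "dist (dx_diff_quotient f x y) (dx_diff_quotient f x x) < e"
      if y: "y \<noteq> x" "\<bar>y - x\<bar> < d" for y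
    proof -
      \<comment> \<open>The subtracted term is (y - x) r'(x) = 0, written in the shape of the
        linearization rule.\<close>
      have "norm (r y - r x - (y - x) *\<^sub>R (vderiv f x - vderiv f x - (x - x) *\<^sub>R c))
          \<le> norm (y - x) * (e / 2 * \<bar>y - x\<bar>)"
      proof (rule vector_differentiable_bound_linearization
            [where f' = "\<lambda>u. vderiv f u - vderiv f x - (u - x) *\<^sub>R c" and ?x0.0 = x])
        show "(r has_vector_derivative (vderiv f u - vderiv f x - (u - x) *\<^sub>R c))
            (at u within closed_segment x y)" for u
          using r' by (rule has_vector_derivative_at_within)
        show "norm (vderiv f u - vderiv f x - (u - x) *\<^sub>R c -
            (vderiv f x - vderiv f x - (x - x) *\<^sub>R c)) \<le> e / 2 * \<bar>y - x\<bar>"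
          if u: "u \<in> closed_segment x y" for u
        proof -
          have "\<bar>u - x\<bar> \<le> \<bar>y - x\<bar>"
            using segment_bound(1) [OF u] by simp
          then have "e / 2 * \<bar>u - x\<bar> \<le> e / 2 * \<bar>y - x\<bar>"
            using \<open>0 < e\<close> by (intro mult_left_mono) auto
          then show ?thesis
            using d(2) [of u] \<open>\<bar>u - x\<bar> \<le> \<bar>y - x\<bar>\<close> y(2) by simp
        qed
      qed auto
      then have bound: "norm (r y - r x) \<le> e / 2 * (y - x)\<^sup>2"
        by (simp add: power2_eq_square mult_ac)
      have eq: "dx_diff_quotient f x y - dx_diff_quotient f x x =
          (r y - r x) / complex_of_real ((y - x)\<^sup>2)"
        using y(1) by (simp add: dx_diff_quotient_def r_def c_def scaleR_conv_of_real diff_divide_distrib)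
      have "dist (dx_diff_quotient f x y) (dx_diff_quotient f x x) \<le> e / 2"
        unfolding dist_norm eq norm_divide norm_of_real abs_power2
        using y(1) bound by (subst pos_divide_le_eq) auto
      then show ?thesis
        using \<open>0 < e\<close> by simp
    qed
    with d(1) show "\<forall>\<^sub>F y in at x. dist (dx_diff_quotient f x y) (dx_diff_quotient f x x) < e"
      unfolding eventually_at by (auto simp: dist_real_def)
  qed
qed

lemma continuous_on_generator_integrand:
  assumes "f \<in> C2_functions"
  shows "continuous_on UNIV (generator_integrand f x)"
proof -
  have "isCont (dx_diff_quotient f x) y" for y
  proof (cases "y = x")
    case True
    then show ?thesis
      using dx_diff_quotient_tendsto_diagonal [OF assms] by (simp add: isCont_def)
  next
    case False
    have "isCont f y"
      using C2_functionsD(1) [OF assms] has_vector_derivative_continuous by blast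
    then have "isCont (\<lambda>y. (f y - f x - complex_of_real (y - x) * vderiv f x) /
        complex_of_real ((y - x)\<^sup>2)) y"
      using False by (intro continuous_intros) auto
    moreover have "\<forall>\<^sub>F u in nhds y. u \<noteq> x"
      using False by (rule t1_space_nhds)
    then have "\<forall>\<^sub>F u in nhds y. dx_diff_quotient f x u =
        (f u - f x - complex_of_real (u - x) * vderiv f x) / complex_of_real ((u - x)\<^sup>2)"
      by eventually_elim (auto simp: dx_diff_quotient_def)
    ultimately show ?thesis
      by (simp add: isCont_cong)
  qed
  then have "continuous_on UNIV (dx_diff_quotient f x)"
    by (simp add: continuous_on_eq_continuous_at)
  then show ?thesis
    unfolding generator_integrand_def [abs_def] by (intro continuous_intros) auto
qed

section \<open>Exact splitting of an increment into a drift part and a jump part\<close>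

definition jump_weight :: "real \<Rightarrow> real \<Rightarrow> real" where
  "jump_weight x y = (y - x)\<^sup>2 / (1 + y\<^sup>2)"

text \<open>This equals (y - x) - y \<open>jump_weight x y\<close>: the coefficient of f'(x) that
  remains after the Taylor remainder and the compensating term y f'(x) have been put into the jump
  part.\<close>

definition drift_weight :: "real \<Rightarrow> real \<Rightarrow> real" where
  "drift_weight x y = (y - x) * (1 + x * y) / (1 + y\<^sup>2)"

text \<open>An algebraic identity valid for every \<open>f\<close>: off the diagonal
  \<open>jump_weight\<close> cancels the factor 1 + y^2 and the denominator (y - x)^2, and on the
  diagonal both weights vanish.\<close>

lemma diff_eq_weights_generator_integrand:
  "f y - f x = complex_of_real (jump_weight x y) * generator_integrand f x y +
     complex_of_real (drift_weight x y) * vderiv f x"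
proof (cases "y = x")
  case False
  have pos: "1 + y\<^sup>2 \<noteq> 0"
    by (smt (verit) zero_le_power2)
  have jump: "complex_of_real (jump_weight x y) * generator_integrand f x y =
      f y - f x - complex_of_real (y - x) * vderiv f x +
      complex_of_real (jump_weight x y * y) * vderiv f x"
  proof -
    have "complex_of_real (jump_weight x y) * (complex_of_real (1 + y\<^sup>2) * dx_diff_quotient f x y) =
        complex_of_real ((y - x)\<^sup>2) * dx_diff_quotient f x y"
      using pos unfolding mult.assoc [symmetric] of_real_mult [symmetric] jump_weight_def by simp
    also have "\<dots> = f y - f x - complex_of_real (y - x) * vderiv f x"
      using False by (simp add: dx_diff_quotient_def)
    finally show ?thesis
      by (simp add: generator_integrand_def distrib_left mult.assoc)
  qed
  have drift: "drift_weight x y = (y - x) - jump_weight x y * y"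
    using pos unfolding drift_weight_def jump_weight_def
    by (simp add: divide_simps) (simp add: algebra_simps power2_eq_square)
  show ?thesis
    unfolding jump drift of_real_diff [of "y - x"] left_diff_distrib by simp
qed (simp add: jump_weight_def drift_weight_def)

text \<open>The same splitting for f(y) = 1 / (z - y), where f'(x) = 1 / (z - x)^2 and the integrand
  is the Nevanlinna kernel divided by (z - x)^2. It is checked by clearing denominators, without
  differentiating.\<close>

lemma cauchy_kernel_diff_eq_weights:
  assumes "0 < Im z"
  shows "1 / (z - complex_of_real y) - 1 / (z - complex_of_real x) =
    complex_of_real (jump_weight x y) * (nevanlinna_kernel z y / (z - complex_of_real x)\<^sup>2) +
    complex_of_real (drift_weight x y) * (1 / (z - complex_of_real x)\<^sup>2)"
proof -
  have nz: "z - complex_of_real x \<noteq> 0" "z - complex_of_real y \<noteq> 0"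
    using nonreal_minus_real [OF assms] by auto
  have "complex_of_real (1 + y\<^sup>2) \<noteq> 0"
    unfolding of_real_eq_0_iff by (smt (verit) zero_le_power2)
  then have pos: "1 + (complex_of_real y)\<^sup>2 \<noteq> 0"
    by simp
  show ?thesis
    unfolding jump_weight_def drift_weight_def nevanlinna_kernel_def
    using nz pos by (simp add: divide_simps) (simp add: algebra_simps power2_eq_square)
qed

lemma jump_weight_nonneg: "0 \<le> jump_weight x y"
  by (simp add: jump_weight_def)

lemma
  shows jump_weight_measurable [measurable]: "jump_weight x \<in> borel_measurable borel"
    and drift_weight_measurable [measurable]: "drift_weight x \<in> borel_measurable borel"
  unfolding jump_weight_def drift_weight_def by measurable

lemma jump_weight_le: "jump_weight x y \<le> 2 + 2 * x\<^sup>2"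
proof -
  have "(y - x)\<^sup>2 \<le> 2 * y\<^sup>2 + 2 * x\<^sup>2"
    using zero_le_power2 [of "y + x"] by (simp add: power2_eq_square algebra_simps)
  also have "\<dots> \<le> (2 + 2 * x\<^sup>2) * (1 + y\<^sup>2)"
    by (simp add: algebra_simps)
  finally show ?thesis
    unfolding jump_weight_def by (simp add: divide_simps add_pos_nonneg)
qed

lemma abs_drift_weight_le: "\<bar>drift_weight x y\<bar> \<le> (1 + \<bar>x\<bar>)\<^sup>2"
proof -
  have y1: "\<bar>y\<bar> \<le> 1 + y\<^sup>2"
    using zero_le_power2 [of "\<bar>y\<bar> - 1"] by (simp add: power2_eq_square algebra_simps)
  have "\<bar>(y - x) * (1 + x * y)\<bar> \<le> (\<bar>y\<bar> + \<bar>x\<bar>) * (1 + \<bar>x\<bar> * \<bar>y\<bar>)"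
    unfolding abs_mult by (intro mult_mono) (auto simp: abs_mult [symmetric])
  also have "\<dots> = \<bar>y\<bar> * (1 + x\<^sup>2) + \<bar>x\<bar> * (1 + y\<^sup>2)"
    by (simp add: algebra_simps power2_eq_square abs_mult_self_eq)
  \<comment> \<open>A second copy of |x| (1 + y^2) is added to complete the square (1 +
    |x|)^2.\<close>
  also have "\<dots> \<le> (1 + y\<^sup>2) * (1 + x\<^sup>2) + \<bar>x\<bar> * (1 + y\<^sup>2) + \<bar>x\<bar> * (1 + y\<^sup>2)"
  proof -
    have "\<bar>y\<bar> * (1 + x\<^sup>2) \<le> (1 + y\<^sup>2) * (1 + x\<^sup>2)" "0 \<le> \<bar>x\<bar> * (1 + y\<^sup>2)"
      using y1 by (intro mult_right_mono mult_nonneg_nonneg; simp)+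
    then show ?thesis by linarith
  qed
  also have "\<dots> = (1 + \<bar>x\<bar>)\<^sup>2 * (1 + y\<^sup>2)"
    by (simp add: algebra_simps power2_eq_square abs_mult_self_eq)
  finally show ?thesis
    unfolding drift_weight_def by (simp add: abs_divide divide_simps add_pos_nonneg)
qed

text \<open>Away from the diagonal, the integrand is recovered from the decomposition of \<open>f y - f x\<close>,
  since there the jump weight is bounded below.\<close>
lemma bounded_generator_integrand:
  assumes f: "f \<in> C2_functions" "bounded (range f)"
  shows "bounded (range (generator_integrand f x))"
proof -
  obtain C where C: "\<And>y. norm (f y) \<le> C"
    using f(2) by (auto simp: bounded_iff)
  define B where "B = 2 * C + (1 + \<bar>x\<bar>)\<^sup>2 * norm (vderiv f x)"
  have far: "norm (generator_integrand f x y) \<le> (3 + 2 * x\<^sup>2) * B" if y: "1 < \<bar>y - x\<bar>" for y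
  proof -
    have *: "jump_weight x y * norm (generator_integrand f x y) \<le> B"
    proof -
      have "complex_of_real (jump_weight x y) * generator_integrand f x y =
          (f y - f x) - complex_of_real (drift_weight x y) * vderiv f x"
        using diff_eq_weights_generator_integrand [of f y x] by simp
      then have "jump_weight x y * norm (generator_integrand f x y) =
          norm ((f y - f x) - complex_of_real (drift_weight x y) * vderiv f x)"
        by (metis abs_of_nonneg jump_weight_nonneg norm_mult norm_of_real)
      also have "\<dots> \<le> norm (f y) + norm (f x) + \<bar>drift_weight x y\<bar> * norm (vderiv f x)"
        by (smt (verit) norm_mult norm_of_real norm_triangle_ineq4)
      also have "\<dots> \<le> C + C + (1 + \<bar>x\<bar>)\<^sup>2 * norm (vderiv f x)"
        by (intro add_mono mult_right_mono C abs_drift_weight_le) auto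
      finally show ?thesis
        by (simp add: B_def)
    qed
    \<comment> \<open>The constant 3 + 2 x^2 collects 1 <= (y - x)^2, y^2 <= 2 (y - x)^2 + 2 x^2 and
      2 x^2 <= 2 x^2 (y - x)^2. It bounds the reciprocal of the jump weight.\<close>
    have "1 \<le> (y - x)\<^sup>2"
      using one_le_power [of "\<bar>y - x\<bar>" 2] y by simp
    moreover have "y\<^sup>2 \<le> 2 * (y - x)\<^sup>2 + 2 * x\<^sup>2"
      using zero_le_power2 [of "y - 2 * x"] by (simp add: power2_eq_square algebra_simps)
    moreover have "2 * x\<^sup>2 * 1 \<le> 2 * x\<^sup>2 * (y - x)\<^sup>2"
      using \<open>1 \<le> (y - x)\<^sup>2\<close> by (intro mult_left_mono) auto
    ultimately have "1 + y\<^sup>2 \<le> (3 + 2 * x\<^sup>2) * (y - x)\<^sup>2"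
      by (simp add: algebra_simps)
    then have "1 \<le> (3 + 2 * x\<^sup>2) * jump_weight x y"
      unfolding jump_weight_def by (simp add: divide_simps add_pos_nonneg)
    then have "norm (generator_integrand f x y) \<le>
        (3 + 2 * x\<^sup>2) * jump_weight x y * norm (generator_integrand f x y)"
      by (metis mult_1 mult_right_mono norm_ge_zero)
    also have "\<dots> \<le> (3 + 2 * x\<^sup>2) * B"
      unfolding mult.assoc using * by (intro mult_left_mono) auto
    finally show ?thesis .
  qed
  \<comment> \<open>Near the diagonal the jump weight degenerates, and compactness with continuity
    takes over.\<close>
  have "bounded (generator_integrand f x ` {x - 1..x + 1})"
    using continuous_on_generator_integrand [OF f(1)]
    by (intro compact_imp_bounded compact_continuous_image) (auto intro: continuous_on_subset)
  then obtain D where "\<And>y. \<bar>y - x\<bar> \<le> 1 \<Longrightarrow> norm (generator_integrand f x y) \<le> D"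
    unfolding bounded_iff by (force simp: abs_le_iff)
  with far have "norm (generator_integrand f x y) \<le> max D ((3 + 2 * x\<^sup>2) * B)" for y
    by (cases "\<bar>y - x\<bar> \<le> 1") (force simp: le_max_iff_disj not_le)+
  then show ?thesis
    unfolding bounded_iff by blast
qed

section \<open>Difference quotients as integrals against rescaled jump measures\<close>

definition jump_measure :: "real measure \<Rightarrow> real \<Rightarrow> real \<Rightarrow> real measure" where
  "jump_measure K x t = density K (\<lambda>y. ennreal (jump_weight x y / t))"

definition mean_drift :: "real measure \<Rightarrow> real \<Rightarrow> real \<Rightarrow> real" where
  "mean_drift K x t = (LINT y|K. drift_weight x y) / t"

context real_distribution
begin

lemma sets_jump_measure: "sets (jump_measure M x t) = sets borel"
  by (simp add: jump_measure_def)

lemma finite_jump_measure: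
  assumes "0 < t"
  shows "finite_measure (jump_measure M x t)"
proof
  have "emeasure (jump_measure M x t) (space (jump_measure M x t)) =
      (\<integral>\<^sup>+ y. ennreal (jump_weight x y / t) \<partial>M)"
    by (simp add: jump_measure_def emeasure_density cong: nn_integral_cong)
  also have "\<dots> \<le> (\<integral>\<^sup>+ y. ennreal ((2 + 2 * x\<^sup>2) / t) \<partial>M)"
    using assms by (intro nn_integral_mono ennreal_leI divide_right_mono jump_weight_le) auto
  also have "\<dots> < \<infinity>"
    using emeasure_space_1 by simp
  finally show "emeasure (jump_measure M x t) (space (jump_measure M x t)) \<noteq> \<infinity>"
    by simp
qed

text \<open>The splitting enters as a hypothesis with arbitrary \<open>h\<close> and
  \<open>d\<close>, so that one statement serves both the Cauchy kernels, which identify the limit,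
  and the test functions of the generator. Bounded weights make all the integrals exist.\<close>

lemma difference_quotient_eq_jump_measure:
  fixes f h :: "real \<Rightarrow> complex"
  assumes t: "0 < t"
    and f: "f \<in> borel_measurable borel" "bounded (range f)"
    and h [measurable]: "h \<in> borel_measurable borel" and h_bdd: "bounded (range h)"
    and decomp: "\<And>y. f y - f x = complex_of_real (jump_weight x y) * h y +
      complex_of_real (drift_weight x y) * d"
  shows "(integral\<^sup>L M f - f x) /\<^sub>R t =
    complex_of_real (mean_drift M x t) * d + integral\<^sup>L (jump_measure M x t) h"
proof -
  obtain C where C: "\<And>y. norm (f y) \<le> C"
    using f(2) by (auto simp: bounded_iff)
  obtain D where D: "\<And>y. norm (h y) \<le> D"
    using h_bdd by (auto simp: bounded_iff)
  have int_f: "integrable M f"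
    using f(1) C by (intro integrable_const_bound [where B = C]) auto
  have int_drift: "integrable M (drift_weight x)"
    using abs_drift_weight_le by (intro integrable_const_bound [where B = "(1 + \<bar>x\<bar>)\<^sup>2"]) auto
  have int_jump: "integrable M (\<lambda>y. complex_of_real (jump_weight x y) * h y)"
  proof (rule integrable_const_bound [where B = "(2 + 2 * x\<^sup>2) * D"])
    show "AE y in M. norm (complex_of_real (jump_weight x y) * h y) \<le> (2 + 2 * x\<^sup>2) * D"
      unfolding norm_mult norm_of_real
      using jump_weight_le [of x] jump_weight_nonneg [of x] D
      by (intro AE_I2 mult_mono) (auto intro: order_trans [OF norm_ge_zero D])
  qed measurable
  have "integral\<^sup>L M f - f x = (LINT y|M. f y - f x)"
    using int_f prob_space by simp
  also have "\<dots> = (LINT y|M. complex_of_real (jump_weight x y) * h y) +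
      complex_of_real (LINT y|M. drift_weight x y) * d"
    unfolding decomp using int_jump int_drift
    by (subst Bochner_Integration.integral_add) (auto simp: complex_of_real_integrable_eq)
  finally have eq: "integral\<^sup>L M f - f x = \<dots>" .
  have "integral\<^sup>L (jump_measure M x t) h = (LINT y|M. (jump_weight x y / t) *\<^sub>R h y)"
    unfolding jump_measure_def using t
    by (intro integral_density) (auto simp: jump_weight_nonneg)
  also have "\<dots> = (LINT y|M. complex_of_real (jump_weight x y) * h y) /\<^sub>R t"
    by (subst integral_scaleR_right [symmetric])
      (auto simp: scaleR_conv_of_real divide_inverse mult_ac intro!: Bochner_Integration.integral_cong)
  finally show ?thesis
    unfolding eq mean_drift_def by (simp add: scaleR_conv_of_real divide_inverse algebra_simps)
qed

end

section \<open>Transition semigroups\<close>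

lemma has_vector_derivative_iff_tendsto:
  "(h has_vector_derivative D) (at a within S) \<longleftrightarrow>
    ((\<lambda>t. (h t - h a) /\<^sub>R (t - a)) \<longlongrightarrow> D) (at a within S)"
proof -
  have "(h has_vector_derivative D) (at a within S) \<longleftrightarrow>
      ((\<lambda>t. norm (h t - h a - (t - a) *\<^sub>R D) / norm (t - a)) \<longlongrightarrow> 0) (at a within S)"
    unfolding has_vector_derivative_def has_derivative_iff_norm
    by (simp add: bounded_linear_scaleR_left)
  also have "\<dots> \<longleftrightarrow> ((\<lambda>t. norm ((h t - h a) /\<^sub>R (t - a) - D)) \<longlongrightarrow> 0) (at a within S)"
  proof (rule Lim_cong_within)
    fix t assume "t \<noteq> a"
    then have "(h t - h a) /\<^sub>R (t - a) - D = (h t - h a - (t - a) *\<^sub>R D) /\<^sub>R (t - a)"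
      by (simp add: scaleR_diff_right)
    then show "norm (h t - h a - (t - a) *\<^sub>R D) / norm (t - a) =
        norm ((h t - h a) /\<^sub>R (t - a) - D)"
      by (simp add: divide_inverse mult.commute)
  qed auto
  also have "\<dots> \<longleftrightarrow> ((\<lambda>t. (h t - h a) /\<^sub>R (t - a)) \<longlongrightarrow> D) (at a within S)"
    unfolding tendsto_norm_zero_iff LIM_zero_iff ..
  finally show ?thesis .
qed

text \<open>The real-valued rule \<open>integral_bind\<close> is applied to the real and imaginary
  parts; boundedness of \<open>f\<close> gives the integrability needed to reassemble them.\<close>

lemma integral_bind_bounded:
  fixes f :: "real \<Rightarrow> complex"
  assumes f: "f \<in> bounded_borel" and M: "real_distribution M"
    and N: "N \<in> borel \<rightarrow>\<^sub>M prob_algebra borel"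
  shows "integral\<^sup>L (M \<bind> N) f = (LINT x|M. integral\<^sup>L (N x) f)"
proof -
  interpret M: real_distribution M by fact
  have f_meas [measurable]: "f \<in> borel_measurable borel"
    using f by (simp add: bounded_borel_def)
  obtain C where C: "\<And>y. norm (f y) \<le> C"
    using f by (auto simp: bounded_borel_def bounded_iff)
  have Nx: "real_distribution (N x)" for x
    using measurable_space [OF N, of x]
    by (simp add: space_prob_algebra real_distribution_def real_distribution_axioms_def)
  have N' [measurable]: "N \<in> M \<rightarrow>\<^sub>M subprob_algebra borel"
    using measurable_prob_algebraD [OF N] by simp
  have int: "integrable K f" if "real_distribution K" for K
  proof -
    interpret K: real_distribution K by fact
    show ?thesis
      using C by (intro K.integrable_const_bound [where B = C]) auto
  qed
  have meas: "(\<lambda>x. integral\<^sup>L (N x) f) \<in> borel_measurable M"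
    by (rule measurable_compose [OF N' integral_measurable_subprob_algebra]) simp
  have "norm (integral\<^sup>L (N x) f) \<le> C" for x
  proof -
    interpret K: real_distribution "N x" by (rule Nx)
    have "norm (integral\<^sup>L (N x) f) \<le> C * measure (N x) UNIV"
      using C K.finite_measure_axioms by (intro norm_integral_le_mass) auto
    then show ?thesis
      using K.prob_space by simp
  qed
  with meas have outer: "integrable M (\<lambda>x. integral\<^sup>L (N x) f)"
    by (intro M.integrable_const_bound [where B = C]) auto
  have bind: "real_distribution (M \<bind> N)"
  proof -
    have "prob_space (M \<bind> N)"
      using Nx by (intro M.prob_space_bind [OF _ N']) (auto simp: real_distribution_def)
    then show ?thesis
      using sets_bind [of M N borel] real_distribution.events_eq_borel [OF Nx]
      by (simp add: real_distribution_def real_distribution_axioms_def)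
  qed
  have real_part: "integral\<^sup>L (M \<bind> N) g = (LINT x|M. integral\<^sup>L (N x) g)"
    if "g \<in> borel_measurable borel" "\<And>y. \<bar>g y\<bar> \<le> C" for g :: "real \<Rightarrow> real"
  proof (rule integral_bind [OF that(1) that(2) N' M.finite_measure_axioms])
    show "AE x in M. emeasure (N x) (space (N x)) \<le> ennreal 1"
      using prob_space.emeasure_space_1 [OF real_distribution.axioms(1) [OF Nx]] by simp
  qed
  show ?thesis
  proof (rule complex_eqI)
    have "\<bar>Re (f y)\<bar> \<le> C" "\<bar>Im (f y)\<bar> \<le> C" for y
      using C [of y] abs_Re_le_cmod [of "f y"] abs_Im_le_cmod [of "f y"] by linarith+
    then have "integral\<^sup>L (M \<bind> N) (\<lambda>y. Re (f y)) = (LINT x|M. LINT y|N x. Re (f y))"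
      and "integral\<^sup>L (M \<bind> N) (\<lambda>y. Im (f y)) = (LINT x|M. LINT y|N x. Im (f y))"
      by (intro real_part; simp)+
    then show "Re (integral\<^sup>L (M \<bind> N) f) = Re (LINT x|M. integral\<^sup>L (N x) f)"
      and "Im (integral\<^sup>L (M \<bind> N) f) = Im (LINT x|M. integral\<^sup>L (N x) f)"
      using int [OF bind] int [OF Nx] outer by simp_all
  qed
qed

context transition_kernels
begin

lemma real_distribution_kernel:
  assumes "0 \<le> s" "s \<le> t"
  shows "real_distribution (k s t x)"
  using measurable_space [OF kernel [OF assms], of x]
  by (simp add: space_prob_algebra real_distribution_def real_distribution_axioms_def)

lemma transition_operator_in_bounded_borel:
  assumes t: "0 \<le> t" and f: "f \<in> bounded_borel"
  shows "transition_operator k t f \<in> bounded_borel"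
proof -
  have "k 0 t \<in> borel \<rightarrow>\<^sub>M subprob_algebra borel"
    using kernel [OF order_refl t] by (rule measurable_prob_algebraD)
  then have "(\<lambda>x. integral\<^sup>L (k 0 t x) f) \<in> borel_measurable borel"
    using f by (intro measurable_compose [OF _ integral_measurable_subprob_algebra])
      (auto simp: bounded_borel_def)
  moreover obtain C where C: "\<And>y. norm (f y) \<le> C"
    using f by (auto simp: bounded_borel_def bounded_iff)
  have "norm (integral\<^sup>L (k 0 t x) f) \<le> C" for x
  proof -
    interpret K: real_distribution "k 0 t x"
      by (rule real_distribution_kernel [OF order_refl t])
    have "norm (integral\<^sup>L (k 0 t x) f) \<le> C * measure (k 0 t x) UNIV"
      using C K.finite_measure_axioms by (intro norm_integral_le_mass) auto
    then show ?thesis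
      using K.prob_space by simp
  qed
  then have "bounded (range (\<lambda>x. integral\<^sup>L (k 0 t x) f))"
    by (auto simp: bounded_iff)
  ultimately show ?thesis
    by (simp add: bounded_borel_def transition_operator_def [abs_def])
qed

text \<open>Chapman-Kolmogorov as an identity of measures, the form in which arbitrary bounded
  functions can be integrated.\<close>

lemma kernel_eq_bind:
  assumes "0 \<le> s" "s \<le> t" "t \<le> u"
  shows "k s u x = k s t x \<bind> k t u"
proof (rule measure_eqI)
  interpret K: real_distribution "k s t x"
    using assms by (intro real_distribution_kernel)
  have ktu: "k t u \<in> k s t x \<rightarrow>\<^sub>M subprob_algebra borel"
    using measurable_prob_algebraD [OF kernel [of t u]] assms by simp
  show "sets (k s u x) = sets (k s t x \<bind> k t u)"
    using real_distribution.events_eq_borel [OF real_distribution_kernel] assms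
      sets_bind [of "k s t x" "k t u" borel] by simp
  fix B assume "B \<in> sets (k s u x)"
  then have "B \<in> sets borel"
    using real_distribution.events_eq_borel [OF real_distribution_kernel, of s u x] assms by simp
  then show "emeasure (k s u x) B = emeasure (k s t x \<bind> k t u) B"
    using chapman_kolmogorov [OF assms] by (simp add: emeasure_bind [OF _ ktu])
qed

lemma transition_operator_semigroup:
  assumes "stationary k" and st: "0 \<le> s" "0 \<le> t" and f: "f \<in> bounded_borel"
  shows "transition_operator k s (transition_operator k t f) = transition_operator k (s + t) f"
proof
  fix x
  \<comment> \<open>Stationarity moves the second time interval back to the origin.\<close>
  have "k s (s + t) = k 0 t"
    using assms(1) [unfolded stationary_def, rule_format, of s "s + t"] st by (intro ext) simp
  then have "k 0 (s + t) x = k 0 s x \<bind> k 0 t"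
    using kernel_eq_bind [of 0 s "s + t" x] st by simp
  then show "transition_operator k s (transition_operator k t f) x = transition_operator k (s + t) f x"
    unfolding transition_operator_def
    using integral_bind_bounded [OF f real_distribution_kernel kernel, of 0 s 0 t x] st by simp
qed

end

section \<open>Homogeneity, convergence of the jump measures, and the generator\<close>

lemma cauchy_transform_return: "cauchy_transform (return borel x) z = 1 / (z - complex_of_real x)"
  unfolding cauchy_transform_def by (subst integral_return) auto

text \<open>Homogeneity at y = 0 composes with the reciprocal Cauchy transform w - x of the point
  mass at x, which reduces every starting point to 0.\<close>

lemma cauchy_transform_homogeneous_kernel:
  assumes "monotone_homogeneous k" "0 \<le> s" "s \<le> t" "0 < Im z"
  shows "cauchy_transform (k s t x) z =
    1 / (recip_cauchy_transform (k s t 0) z - complex_of_real x)"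
proof -
  have "is_monotone_convolution (return borel x) (k s t 0) (k s t (x + 0))"
    using assms unfolding monotone_homogeneous_def by blast
  then have "recip_cauchy_transform (k s t x) z =
      recip_cauchy_transform (return borel x) (recip_cauchy_transform (k s t 0) z)"
    using assms(4) by (simp add: is_monotone_convolution_def)
  \<comment> \<open>Taking reciprocals twice is the identity even at 0, where 1 / 0 = 0, so
    nonvanishing of the Cauchy transform need not be checked.\<close>
  then have "1 / (1 / cauchy_transform (k s t x) z) =
      1 / (1 / (1 / (recip_cauchy_transform (k s t 0) z - complex_of_real x)))"
    by (simp add: recip_cauchy_transform_def cauchy_transform_return)
  then show ?thesis
    by simp
qed

context transition_kernels
begin

text \<open>Differentiation of 1 / (F_t(z) - x) at t = 0, where F_0(z) = z; the minus sign from the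
  reciprocal matches the one in \<open>generating_pair\<close>.\<close>

lemma cauchy_transform_has_derivative:
  assumes "monotone_homogeneous k" "generating_pair (\<lambda>t. k 0 t 0) \<gamma> \<rho>" and z: "0 < Im z"
  shows "((\<lambda>t. cauchy_transform (k 0 t x) z) has_vector_derivative
    (complex_of_real \<gamma> + integral\<^sup>L \<rho> (nevanlinna_kernel z)) / (z - complex_of_real x)\<^sup>2)
    (at 0 within {0..})"
proof -
  obtain a where a: "((\<lambda>t. recip_cauchy_transform (k 0 t 0) z) has_vector_derivative a) (at 0 within {0..})"
    and a_eq: "- a = complex_of_real \<gamma> + integral\<^sup>L \<rho> (nevanlinna_kernel z)"
    using assms(2) z unfolding generating_pair_def nevanlinna_kernel_def [abs_def] by blast
  have F0: "recip_cauchy_transform (k 0 0 0) z = z"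
    by (simp add: kernel_refl recip_cauchy_transform_def cauchy_transform_return)
  have "((\<lambda>t. 1 / (recip_cauchy_transform (k 0 t 0) z - complex_of_real x)) has_vector_derivative
      - a / (z - complex_of_real x)\<^sup>2) (at 0 within {0..})"
    unfolding has_vector_derivative_def
    using a [unfolded has_vector_derivative_def] nonreal_minus_real [OF z, of x]
    by (auto intro!: derivative_eq_intros simp: F0 power2_eq_square scaleR_conv_of_real)
  then show ?thesis
    unfolding a_eq
  proof (rule has_vector_derivative_transform [rotated 2])
    show "cauchy_transform (k 0 t x) z = 1 / (recip_cauchy_transform (k 0 t 0) z - complex_of_real x)"
      if "t \<in> {0..}" for t
      using that by (intro cauchy_transform_homogeneous_kernel assms) auto
  qed simp
qed

text \<open>The limits do not depend on the starting point x: in the derivative of the Cauchy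
  transform, x occurs only in the factor 1 / (z - x)^2, and the same factor comes out of the
  splitting of the Cauchy kernel.\<close>

lemma jump_measures_tendsto:
  fixes g :: "real \<Rightarrow> 'b::{banach, second_countable_topology}"
  assumes hom: "monotone_homogeneous k" and gen: "generating_pair (\<lambda>t. k 0 t 0) \<gamma> \<rho>"
    and X: "\<And>n. 0 < X n" "X \<longlonglongrightarrow> 0"
  shows "(\<lambda>n. mean_drift (k 0 (X n) x) x (X n)) \<longlonglongrightarrow> \<gamma>"
    and "continuous_on UNIV g \<Longrightarrow> bounded (range g) \<Longrightarrow>
      (\<lambda>n. integral\<^sup>L (jump_measure (k 0 (X n) x) x (X n)) g) \<longlonglongrightarrow> integral\<^sup>L \<rho> g"
proof -
  have rd: "real_distribution (k 0 (X n) x)" for n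
    using X(1) [of n] by (intro real_distribution_kernel) auto
  have \<rho>: "finite_measure \<rho>" "sets \<rho> = sets borel"
    using gen by (auto simp: generating_pair_def)
  have conv: "(\<lambda>n. complex_of_real (mean_drift (k 0 (X n) x) x (X n)) +
      integral\<^sup>L (jump_measure (k 0 (X n) x) x (X n)) (nevanlinna_kernel z))
    \<longlonglongrightarrow> complex_of_real \<gamma> + integral\<^sup>L \<rho> (nevanlinna_kernel z)" if z: "0 < Im z" for z
  proof -
    define w where "w = (z - complex_of_real x)\<^sup>2"
    have w: "w \<noteq> 0"
      using nonreal_minus_real [OF z] by (simp add: w_def)
    have "(cauchy_transform (k 0 (X n) x) z - 1 / (z - complex_of_real x)) /\<^sub>R X n =
        complex_of_real (mean_drift (k 0 (X n) x) x (X n)) * (1 / w) +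
        integral\<^sup>L (jump_measure (k 0 (X n) x) x (X n)) (\<lambda>y. nevanlinna_kernel z y / w)" for n
      unfolding cauchy_transform_def w_def
    proof (rule real_distribution.difference_quotient_eq_jump_measure [OF rd X(1)])
      show "bounded (range (\<lambda>y. 1 / (z - complex_of_real y)))"
        using norm_cauchy_kernel_le [OF z] unfolding bounded_iff by blast
      have "norm (nevanlinna_kernel z y / (z - complex_of_real x)\<^sup>2) \<le>
          (norm z + norm (1 + z\<^sup>2) * (1 / Im z)) / norm ((z - complex_of_real x)\<^sup>2)" for y
        unfolding norm_divide by (intro divide_right_mono norm_nevanlinna_kernel_le z) simp
      then show "bounded (range (\<lambda>y. nevanlinna_kernel z y / (z - complex_of_real x)\<^sup>2))"
        unfolding bounded_iff by blast
    qed (use cauchy_kernel_diff_eq_weights [OF z] in \<open>auto simp: borel_measurable_cauchy_kernel\<close>)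
    \<comment> \<open>Multiplying by \<open>w\<close> removes this factor and leaves the Nevanlinna
      form required by \<open>nevanlinna_continuity\<close>.\<close>
    then have quotient: "w * ((cauchy_transform (k 0 (X n) x) z - 1 / (z - complex_of_real x)) /\<^sub>R X n) =
        complex_of_real (mean_drift (k 0 (X n) x) x (X n)) +
        integral\<^sup>L (jump_measure (k 0 (X n) x) x (X n)) (nevanlinna_kernel z)" for n
      using w by (simp add: distrib_left)
    have "((\<lambda>t. (cauchy_transform (k 0 t x) z - 1 / (z - complex_of_real x)) /\<^sub>R t) \<longlongrightarrow>
        (complex_of_real \<gamma> + integral\<^sup>L \<rho> (nevanlinna_kernel z)) / w) (at 0 within {0..})"
      using cauchy_transform_has_derivative [OF hom gen z, of x]
      unfolding has_vector_derivative_iff_tendsto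
      by (simp add: kernel_refl cauchy_transform_return w_def)
    then have "(\<lambda>n. (cauchy_transform (k 0 (X n) x) z - 1 / (z - complex_of_real x)) /\<^sub>R X n) \<longlonglongrightarrow>
        (complex_of_real \<gamma> + integral\<^sup>L \<rho> (nevanlinna_kernel z)) / w"
      using X unfolding tendsto_at_iff_sequentially comp_def
      by (auto simp: less_imp_le less_imp_neq [symmetric])
    from tendsto_mult_left [OF this, of w] show ?thesis
      unfolding quotient using w by simp
  qed
  show "(\<lambda>n. mean_drift (k 0 (X n) x) x (X n)) \<longlonglongrightarrow> \<gamma>"
    by (rule nevanlinna_continuity(1) [OF _ _ \<rho> conv])
      (rule real_distribution.finite_jump_measure [OF rd X(1)]
        real_distribution.sets_jump_measure [OF rd])+
  show "(\<lambda>n. integral\<^sup>L (jump_measure (k 0 (X n) x) x (X n)) g) \<longlonglongrightarrow> integral\<^sup>L \<rho> g"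
    if "continuous_on UNIV g" "bounded (range g)"
    by (rule nevanlinna_continuity(2) [OF _ _ \<rho> conv that])
      (rule real_distribution.finite_jump_measure [OF rd X(1)]
        real_distribution.sets_jump_measure [OF rd])+
qed

lemma transition_operator_has_derivative:
  assumes hom: "monotone_homogeneous k" and gen: "generating_pair (\<lambda>t. k 0 t 0) \<gamma> \<rho>"
    and f: "f \<in> bounded_continuous" "f \<in> C2_functions"
  shows "((\<lambda>t. transition_operator k t f x) has_vector_derivative
    (complex_of_real \<gamma> * vderiv f x + integral\<^sup>L \<rho> (generator_integrand f x))) (at 0 within {0..})"
  unfolding has_vector_derivative_iff_tendsto tendsto_at_iff_sequentially comp_def
proof (intro allI impI)
  fix X :: "nat \<Rightarrow> real"
  assume "\<forall>n. X n \<in> {0..} - {0}" and lim: "X \<longlonglongrightarrow> 0"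
  then have X: "0 < X n" for n
    by (simp add: less_le)
  have cont: "continuous_on UNIV f" and bdd: "bounded (range f)"
    using f(1) by (auto simp: bounded_continuous_def)
  then have f_meas: "f \<in> borel_measurable borel"
    using borel_measurable_continuous_onI by blast
  note h = continuous_on_generator_integrand [OF f(2), of x] bounded_generator_integrand [OF f(2) bdd, of x]
  have "real_distribution (k 0 (X n) x)" for n
    using X [of n] by (intro real_distribution_kernel) auto
  \<comment> \<open>The identity used for the Cauchy kernels, now with
    \<open>generator_integrand f x\<close> as \<open>h\<close> and f'(x) as \<open>d\<close>; the
    integrand is bounded and continuous, so weak convergence applies.\<close>
  from real_distribution.difference_quotient_eq_jump_measure [OF this X f_meas bdd
      borel_measurable_continuous_onI [OF h(1)] h(2) diff_eq_weights_generator_integrand]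
  have "(transition_operator k (X n) f x - transition_operator k 0 f x) /\<^sub>R (X n - 0) =
      complex_of_real (mean_drift (k 0 (X n) x) x (X n)) * vderiv f x +
      integral\<^sup>L (jump_measure (k 0 (X n) x) x (X n)) (generator_integrand f x)" for n
    unfolding transition_operator_def kernel_refl [OF order_refl] using f_meas
    by (simp add: integral_return)
  then show "(\<lambda>n. (transition_operator k (X n) f x - transition_operator k 0 f x) /\<^sub>R (X n - 0))
      \<longlonglongrightarrow> complex_of_real \<gamma> * vderiv f x + integral\<^sup>L \<rho> (generator_integrand f x)"
    by (simp only:) (intro tendsto_intros jump_measures_tendsto [OF hom gen X lim] h)
qed

end

theorem theorem4p28:
  fixes P :: "'a measure"
    and k :: "real \<Rightarrow> real \<Rightarrow> real \<Rightarrow> real measure"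
    and Fil :: "real \<Rightarrow> 'a measure"
    and M :: "real \<Rightarrow> 'a \<Rightarrow> real"
    and \<gamma> :: real
    and \<rho> :: "real measure"
  assumes "markov_process P k Fil M"
    and "monotone_homogeneous k"
    and "stationary k"
    and "generating_pair (\<lambda>t. k 0 t 0) \<gamma> \<rho>"
  shows "(\<forall>t\<ge>0. \<forall>f\<in>bounded_borel. transition_operator k t f \<in> bounded_borel) \<and>
    (\<forall>s\<ge>0. \<forall>t\<ge>0. \<forall>f\<in>bounded_borel.
       transition_operator k s (transition_operator k t f) = transition_operator k (s + t) f) \<and>
    (\<forall>f\<in>bounded_continuous \<inter> C2_functions. \<forall>x.
       integrable \<rho> (\<lambda>y. complex_of_real (1 + y\<^sup>2) * dx_diff_quotient f x y
                          + complex_of_real y * vderiv f x) \<and>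
       ((\<lambda>t. transition_operator k t f x) has_vector_derivative
          (complex_of_real \<gamma> * vderiv f x +
           (LINT y|\<rho>. complex_of_real (1 + y\<^sup>2) * dx_diff_quotient f x y
                       + complex_of_real y * vderiv f x)))
         (at 0 within {0..}))"
proof -
  interpret transition_kernels k
    using assms(1) by (rule markov_process.axioms)
  have \<rho>: "finite_measure \<rho>" "sets \<rho> = sets borel"
    using assms(4) by (auto simp: generating_pair_def)
  \<comment> \<open>Integrability is recorded separately because a non-integrable integrand would
    have integral 0 by convention.\<close>
  have "integrable \<rho> (generator_integrand f x)"
    if f: "f \<in> bounded_continuous" "f \<in> C2_functions" for f x
  proof -
    interpret finite_measure \<rho> by fact
    have "bounded (range (generator_integrand f x))"
      using f by (intro bounded_generator_integrand) (auto simp: bounded_continuous_def)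
    moreover have "generator_integrand f x \<in> borel_measurable \<rho>"
      using borel_measurable_continuous_onI [OF continuous_on_generator_integrand [OF f(2)]]
        measurable_cong_sets [OF \<rho>(2) refl] by blast
    ultimately show ?thesis
      unfolding bounded_iff by (metis integrable_const_bound AE_I2 rangeI)
  qed
  then show ?thesis
    using transition_operator_in_bounded_borel transition_operator_semigroup [OF assms(3)]
      transition_operator_has_derivative [OF assms(2,4)]
    unfolding generator_integrand_def [abs_def] by blast
qed

end
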